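(* Let $F$ be a field, let $n,k\in\mathbb{Z}^+$, and let $$f(x_1,\ldots,x_n)=a_1x_1^k+\cdots+a_nx_n^k+g(x_1,\ldots,x_n)\in F[x_1,\ldots,x_n],$$ where $a_1,\ldots,a_n\in F\setminus\{0\}$ and $g\in F[x_1,\ldots,x_n]$ has $\deg g<k$. Then, for any finite nonempty subsets $A_1,\ldots,A_n$ of $F$, $$|\{f(x_1,\ldots,x_n):\ x_1\in A_1,\ldots,x_n\in A_n\}|\geq\min\left\{p(F),\ \sum_{i=1}^n\left\lfloor\frac{|A_i|-1}{k}\right\rfloor+1\right\}.$$
   Context: $\mathbb{Z}^+=\{1,2,3,\ldots\}$. For a field $F$, $p(F)$ denotes the additive order of the multiplicative identity of $F$: $p(F)=p$ if $F$ has prime characteristic $p$, and $p(F)=+\infty$ if $F$ has characteristic zero. $\deg g$ is the total degree of $g$; the zero polynomial is allowed as $g$ (its degree is regarded as less than $k$). $\lfloor\alpha\rfloor$ denotes the largest integer not exceeding the real number $\alpha$. *)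

theory Defs
  imports Complex_Main "HOL-Library.Poly_Mapping" "HOL-Library.Extended_Nat"
begin

text \<open>
  Polynomials over \<open>'a\<close> in the variables \<open>x\<^sub>i\<close>, \<open>i :: nat\<close>: finitely supported maps from
  exponent vectors to coefficients, with the ring structure of
  \<^theory>\<open>HOL-Library.Poly_Mapping\<close>.  Thus \<open>single (single i k) c\<close> is \<open>c x\<^sub>i^k\<close>.
\<close>

type_synonym 'a mpoly = "(nat \<Rightarrow>\<^sub>0 nat) \<Rightarrow>\<^sub>0 'a"

definition mp_vars :: "'a::zero mpoly \<Rightarrow> nat set" where
  "mp_vars p = (\<Union>m\<in>Poly_Mapping.keys p. Poly_Mapping.keys m)"

text \<open>The ring \<open>F[x\<^sub>1,\<dots>,x\<^sub>n]\<close>.\<close>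

definition mp_ring :: "nat \<Rightarrow> 'a::zero mpoly set" where
  "mp_ring n = {p. mp_vars p \<subseteq> {1..n}}"

definition monom_degree :: "(nat \<Rightarrow>\<^sub>0 nat) \<Rightarrow> nat" where
  "monom_degree m = (\<Sum>i\<in>Poly_Mapping.keys m. Poly_Mapping.lookup m i)"

text \<open>
  By the inserted \<open>0\<close>, the zero polynomial has total degree \<open>0\<close>; in particular its degree is
  less than every positive \<open>k\<close>.
\<close>

definition total_degree :: "'a::zero mpoly \<Rightarrow> nat" where
  "total_degree p = Max (insert 0 (monom_degree ` Poly_Mapping.keys p))"

definition mp_eval :: "'a::comm_semiring_1 mpoly \<Rightarrow> (nat \<Rightarrow> 'a) \<Rightarrow> 'a" where
  "mp_eval p x = (\<Sum>m\<in>Poly_Mapping.keys p. Poly_Mapping.lookup p m *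
                    (\<Prod>i\<in>Poly_Mapping.keys m. x i ^ Poly_Mapping.lookup m i))"

text \<open>
  The additive order of the multiplicative identity of a field.  The library's characteristic
  \<open>CHAR('a)\<close> is \<open>0\<close> where this order is infinite.
\<close>

definition char_order :: "'a::field itself \<Rightarrow> enat" where
  "char_order _ = (if CHAR('a) = 0 then \<infinity> else enat CHAR('a))"

end

theory Submission
  imports Defs "HOL-Library.FuncSet"
begin

text \<open>
  The polynomial method.  On a set \<open>A\<close> with \<open>d + 1\<close> elements there are weights \<open>w\<close> such that
  \<open>\<Sum>x\<in>A. w x * x ^ j\<close> is \<open>0\<close> for \<open>j < d\<close> and \<open>1\<close> for \<open>j = d\<close>.  With \<open>d\<^sub>i = k m\<^sub>i\<close> and
  \<open>N = \<Sum>m\<^sub>i\<close>, the product of these weights over the coordinates gives a functional that kills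
  every polynomial of degree less than \<open>k N\<close>, and sends \<open>(\<Sum>a\<^sub>i x\<^sub>i^k)^N\<close> to a multinomial
  coefficient times \<open>\<Prod>a\<^sub>i^m\<^sub>i\<close>, which does not vanish if \<open>N\<close> is below the characteristic.  If \<open>f\<close>
  had at most \<open>N\<close> values on the grid, then some product of \<open>N\<close> factors \<open>f - c\<close> would vanish on
  the grid, although its leading part is \<open>(\<Sum>a\<^sub>i x\<^sub>i^k)^N\<close>.
\<close>

declare One_nat_def [simp del]

section \<open>Moments of weights on a finite set\<close>

text \<open>These are the weights of the divided difference over \<open>A\<close>. A new point
  \<open>z\<close> is added by dividing the old weights by \<open>x - z\<close>, because
  \<open>(x ^ j - z ^ j) / (x - z)\<close> is a polynomial in \<open>x\<close> of degree below
  \<open>j\<close>.\<close>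

lemma extraction_weights_exist:
  fixes A :: "'a::field set"
  assumes "card A = Suc d"
  shows "\<exists>w. (\<forall>j<d. (\<Sum>x\<in>A. w x * x ^ j) = 0) \<and> (\<Sum>x\<in>A. w x * x ^ d) = 1"
  using assms
proof (induction d arbitrary: A)
  case 0
  then obtain x where "A = {x}" by (metis One_nat_def card_1_singletonE)
  then show ?case by (intro exI[of _ "\<lambda>_. 1"]) simp
next
  case (Suc d)
  then obtain z B where A: "A = insert z B" "z \<notin> B" and B: "card B = Suc d"
    by (metis card_Suc_eq)
  have fin: "finite B" using B by (metis card.infinite nat.distinct(1))
  obtain w where w: "\<And>j. j < d \<Longrightarrow> (\<Sum>x\<in>B. w x * x ^ j) = 0" "(\<Sum>x\<in>B. w x * x ^ d) = 1"
    using Suc.IH[OF B] by blast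
  \<comment> \<open>The weight at \<open>z\<close> makes all weights sum to 0, so
    \<open>z ^ j\<close> can be subtracted from every \<open>x ^ j\<close>.\<close>
  define v where "v x = (if x = z then - (\<Sum>y\<in>B. w y / (y - z)) else w x / (x - z))" for x
  have v: "(\<Sum>x\<in>A. v x * x ^ j) = (\<Sum>t<j. z ^ (j - Suc t) * (\<Sum>x\<in>B. w x * x ^ t))" for j
  proof -
    have "(\<Sum>x\<in>A. v x * x ^ j) = v z * z ^ j + (\<Sum>x\<in>B. v x * x ^ j)"
      using A fin by simp
    also have "(\<Sum>x\<in>B. v x * x ^ j) = (\<Sum>x\<in>B. w x / (x - z) * x ^ j)"
      using A by (intro sum.cong) (auto simp: v_def)
    also have "v z * z ^ j + \<dots> = (\<Sum>x\<in>B. w x / (x - z) * (x ^ j - z ^ j))"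
      by (simp add: v_def sum_distrib_right right_diff_distrib sum_subtractf)
    also have "\<dots> = (\<Sum>x\<in>B. \<Sum>t<j. z ^ (j - Suc t) * (w x * x ^ t))"
    proof (intro sum.cong refl)
      fix x assume "x \<in> B"
      then have "x - z \<noteq> 0" using A by auto
      moreover have "x ^ j - z ^ j = (x - z) * (\<Sum>t<j. z ^ (j - Suc t) * x ^ t)"
        by (rule power_diff_sumr2)
      ultimately show "w x / (x - z) * (x ^ j - z ^ j) = (\<Sum>t<j. z ^ (j - Suc t) * (w x * x ^ t))"
        by (simp add: sum_distrib_left mult_ac)
    qed
    also have "\<dots> = (\<Sum>t<j. z ^ (j - Suc t) * (\<Sum>x\<in>B. w x * x ^ t))"
      by (subst sum.swap) (simp add: sum_distrib_left)
    finally show ?thesis .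
  qed
  have "\<forall>j<Suc d. (\<Sum>x\<in>A. v x * x ^ j) = 0"
    by (auto simp: v w(1) intro!: sum.neutral)
  \<comment> \<open>Of the sum over \<open>t < Suc d\<close> only \<open>t = d\<close> survives,
    with coefficient \<open>z ^ 0\<close>.\<close>
  moreover have "(\<Sum>x\<in>A. v x * x ^ Suc d) = 1"
    unfolding v by (simp add: w)
  ultimately show ?case by blast
qed

section \<open>The product functional on a grid\<close>

text \<open>The coordinates outside \<open>{1..n}\<close> are set to the irrelevant value \<open>0\<close>.\<close>

primrec grid_functional ::
  "(nat \<Rightarrow> 'a::field set) \<Rightarrow> (nat \<Rightarrow> 'a \<Rightarrow> 'a) \<Rightarrow> nat \<Rightarrow> ((nat \<Rightarrow> 'a) \<Rightarrow> 'a) \<Rightarrow> 'a" where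
  "grid_functional A w 0 h = h (\<lambda>_. 0)"
| "grid_functional A w (Suc n) h =
    (\<Sum>y\<in>A (Suc n). w (Suc n) y * grid_functional A w n (\<lambda>x. h (x(Suc n := y))))"

lemma grid_functional_zero [simp]: "grid_functional A w n (\<lambda>x. 0) = 0"
  by (induction n) auto

lemma grid_functional_add:
  "grid_functional A w n (\<lambda>x. h x + h' x) = grid_functional A w n h + grid_functional A w n h'"
  by (induction n arbitrary: h h') (auto simp: sum.distrib algebra_simps)

lemma grid_functional_cmult:
  "grid_functional A w n (\<lambda>x. c * h x) = c * grid_functional A w n h"
  by (induction n arbitrary: h) (auto simp: sum_distrib_left mult_ac)

lemma grid_functional_sum:
  "finite J \<Longrightarrow> grid_functional A w n (\<lambda>x. \<Sum>j\<in>J. h j x) = (\<Sum>j\<in>J. grid_functional A w n (h j))"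
  by (induction J rule: finite_induct) (auto simp: grid_functional_add)

lemma grid_functional_eq_0:
  assumes "\<And>x. (\<And>i. i \<in> {1..n} \<Longrightarrow> x i \<in> A i) \<Longrightarrow> h x = 0"
  shows "grid_functional A w n h = 0"
  using assms
proof (induction n arbitrary: h)
  case (Suc n)
  have "grid_functional A w n (\<lambda>x. h (x(Suc n := y))) = 0" if "y \<in> A (Suc n)" for y
    by (rule Suc.IH, rule Suc.prems) (use that in auto)
  then show ?case by simp
qed simp

text \<open>The functional is a tensor product of one-variable functionals, so each coordinate
  factors out in turn. This reduces degree arguments to one-variable moments.\<close>

lemma grid_functional_monomial:
  "grid_functional A w n (\<lambda>x. \<Prod>i=1..n. x i ^ e i) = (\<Prod>i=1..n. \<Sum>y\<in>A i. w i y * y ^ e i)"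
proof (induction n)
  case (Suc n)
  have "(\<Prod>i=1..Suc n. (x(Suc n := y)) i ^ e i) = y ^ e (Suc n) * (\<Prod>i=1..n. x i ^ e i)"
    for x :: "nat \<Rightarrow> 'a" and y
  proof -
    have "(\<Prod>i=1..n. (x(Suc n := y)) i ^ e i) = (\<Prod>i=1..n. x i ^ e i)"
      by (intro prod.cong) auto
    then show ?thesis by (simp add: mult.commute)
  qed
  then show ?case
    by (simp only: grid_functional.simps grid_functional_cmult Suc.IH)
       (simp add: sum_distrib_right mult_ac)
qed simp

section \<open>Polynomial functions of bounded degree\<close>

text \<open>A predicate on functions: some representing polynomial has degree below
  \<open>D\<close>, which is all that linearity arguments need, even over finite fields. The strict
  bound admits the zero function for every \<open>D\<close>.\<close>

inductive deg_less :: "nat \<Rightarrow> nat \<Rightarrow> ((nat \<Rightarrow> 'a::field) \<Rightarrow> 'a) \<Rightarrow> bool" for n D where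
  zero: "deg_less n D (\<lambda>x. 0)"
| add_monomial: "deg_less n D h \<Longrightarrow> (\<Sum>i=1..n. e i) < D \<Longrightarrow>
    deg_less n D (\<lambda>x. c * (\<Prod>i=1..n. x i ^ e i) + h x)"

lemma deg_less_monomial:
  "(\<Sum>i=1..n. e i) < D \<Longrightarrow> deg_less n D (\<lambda>x. c * (\<Prod>i=1..n. x i ^ e i))"
  using deg_less.add_monomial[OF deg_less.zero] by simp

lemma deg_less_const: "0 < D \<Longrightarrow> deg_less n D (\<lambda>x. c)"
  using deg_less_monomial[of "\<lambda>_. 0" n D c] by simp

lemma deg_less_add:
  assumes "deg_less n D h" "deg_less n D h'"
  shows "deg_less n D (\<lambda>x. h x + h' x)"
  using assms
proof (induction rule: deg_less.induct)
  case (add_monomial h e c)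
  then show ?case using deg_less.add_monomial[of n D "\<lambda>x. h x + h' x" e c]
    by (simp add: add.assoc)
qed simp

lemma deg_less_sum:
  "finite J \<Longrightarrow> (\<And>j. j \<in> J \<Longrightarrow> deg_less n D (h j)) \<Longrightarrow> deg_less n D (\<lambda>x. \<Sum>j\<in>J. h j x)"
  by (induction J rule: finite_induct) (auto intro: deg_less.zero deg_less_add)

lemma deg_less_mono: "deg_less n D h \<Longrightarrow> D \<le> D' \<Longrightarrow> deg_less n D' h"
  by (induction rule: deg_less.induct) (auto intro: deg_less.intros dest: order_less_le_trans)

text \<open>\<open>Suc D\<close> encodes degree at most \<open>D\<close>; pairing this with a strict
  bound keeps the sum of the degrees sharp.\<close>

lemma deg_less_mult:
  assumes "deg_less n (Suc D) h" "deg_less n E h'"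
  shows "deg_less n (D + E) (\<lambda>x. h x * h' x)"
proof -
  have monom: "deg_less n (D + E) (\<lambda>x. c * (\<Prod>i=1..n. x i ^ e i) * h' x)"
    if e: "(\<Sum>i=1..n. e i) < Suc D" for c e
    using assms(2)
  proof (induction rule: deg_less.induct)
    case zero
    then show ?case by (simp add: deg_less.zero)
  next
    case (add_monomial h' e' c')
    have "(\<Sum>i=1..n. e i + e' i) < D + E"
      using e add_monomial.hyps by (simp add: sum.distrib)
    from deg_less.add_monomial[OF add_monomial.IH this, of "c * c'"] show ?case
      by (simp add: power_add prod.distrib algebra_simps)
  qed
  show ?thesis using assms(1)
  proof (induction rule: deg_less.induct)
    case zero
    then show ?case by (simp add: deg_less.zero)
  next
    case (add_monomial h e c)
    from deg_less_add[OF monom[OF add_monomial.hyps(2), of c] add_monomial.IH]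
    show ?case by (simp add: distrib_right)
  qed
qed

text \<open>A monomial of degree below the sum of the \<open>d i\<close> has some exponent below
  \<open>d i\<close>, and the factor of that coordinate vanishes.\<close>

lemma grid_functional_deg_less:
  assumes "\<And>i j. i \<in> {1..n} \<Longrightarrow> j < d i \<Longrightarrow> (\<Sum>y\<in>A i. w i y * y ^ j) = 0"
    and "deg_less n (\<Sum>i=1..n. d i) h"
  shows "grid_functional A w n h = 0"
  using assms(2)
proof (induction rule: deg_less.induct)
  case (add_monomial h e c)
  then obtain i where "i \<in> {1..n}" "e i < d i"
    by (metis linorder_not_less sum_mono)
  then have "(\<Prod>i=1..n. \<Sum>y\<in>A i. w i y * y ^ e i) = 0"
    using assms(1) by (intro prod_zero bexI[of _ i]) auto
  with add_monomial.IH show ?case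
    by (simp add: grid_functional_add grid_functional_cmult grid_functional_monomial)
qed simp

section \<open>The leading form and its powers\<close>

abbreviation diag_form :: "(nat \<Rightarrow> 'a::field) \<Rightarrow> nat \<Rightarrow> nat \<Rightarrow> (nat \<Rightarrow> 'a) \<Rightarrow> 'a" where
  "diag_form a k n x \<equiv> \<Sum>i=1..n. a i * x i ^ k"

lemma prod_power_delta:
  fixes i n :: nat
  assumes "i \<in> {1..n}"
  shows "(\<Prod>j=1..n. x j ^ (if j = i then k else 0)) = (x i :: 'a::field) ^ k"
  using assms by (simp add: if_distrib[of "power _"] cong: if_cong)

lemma deg_less_diag_form: "deg_less n (Suc k) (diag_form a k n)"
proof (rule deg_less_sum)
  fix i assume i: "i \<in> {1..n}"
  have "deg_less n (Suc k) (\<lambda>x. a i * (\<Prod>j=1..n. x j ^ (if j = i then k else 0)))"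
    by (rule deg_less_monomial) (use i in simp)
  then show "deg_less n (Suc k) (\<lambda>x. a i * x i ^ k)"
    using i by (simp add: prod_power_delta)
qed simp

text \<open>The lower-order parts, which may differ from factor to factor, do not affect the terms
  of degree \<open>k * N\<close>.\<close>

lemma deg_less_prod_minus_power:
  assumes s: "deg_less n (Suc k) s" and h: "\<And>j. deg_less n k (h j)"
  shows "deg_less n (k * N) (\<lambda>x. (\<Prod>j<N. s x + h j x) - s x ^ N)"
proof (induction N)
  case (Suc N)
  have "deg_less n (Suc (k * N)) (\<lambda>x. \<Prod>j<N. s x + h j x)"
  proof (induction N)
    case (Suc N)
    have "deg_less n (Suc k) (\<lambda>x. s x + h N x)"
      using s deg_less_mono[OF h, of "Suc k"] by (intro deg_less_add) auto
    from deg_less_mult[OF this Suc.IH] show ?case by (simp add: mult.commute)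
  qed (simp add: deg_less_const)
  \<comment> \<open>With \<open>P\<close> the product of the first \<open>N\<close> factors, the new
    difference is \<open>s * (P - s ^ N) + P * h N\<close>.\<close>
  from deg_less_add[OF deg_less_mult[OF s Suc.IH]
      deg_less_mult[OF this h, of N, unfolded add.commute[of "k * N" k]]]
  show ?case by (simp add: algebra_simps)
qed (simp add: deg_less.zero)

text \<open>The binomial coefficient divides \<open>fact N\<close>, whose factors
  \<open>1..N\<close> are all nonzero in the field.\<close>

lemma of_nat_binomial_neq_0:
  assumes "CHAR('a::field) = 0 \<or> N < CHAR('a)" and "m \<le> N"
  shows "(of_nat (N choose m) :: 'a) \<noteq> 0"
proof
  assume *: "(of_nat (N choose m) :: 'a) = 0"
  have "(of_nat (fact N) :: 'a) = (\<Prod>i\<in>{1..N}. of_nat i)"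
    by (simp add: fact_prod)
  also have "\<dots> \<noteq> 0"
    using assms(1) by (auto simp: of_nat_eq_0_iff_char_dvd dest: dvd_imp_le)
  finally show False
    using * binomial_fact_lemma[OF assms(2)] by (metis mult_zero_right of_nat_mult)
qed

text \<open>
  The vanishing for exponents below \<open>\<Sum>m\<^sub>i\<close> leaves a single term of the binomial expansion in
  the last coordinate.
\<close>

lemma grid_functional_diag_form_power:
  fixes a :: "nat \<Rightarrow> 'a::field"
  assumes "k \<ge> 1"
    and "\<And>i j. i \<in> {1..n} \<Longrightarrow> j < k * m i \<Longrightarrow> (\<Sum>y\<in>A i. w i y * y ^ j) = 0"
    and "\<And>i. i \<in> {1..n} \<Longrightarrow> (\<Sum>y\<in>A i. w i y * y ^ (k * m i)) = 1"
    and "\<And>i. i \<in> {1..n} \<Longrightarrow> a i \<noteq> 0"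
    and "CHAR('a) = 0 \<or> (\<Sum>i=1..n. m i) < CHAR('a)"
  shows "grid_functional A w n (\<lambda>x. diag_form a k n x ^ (\<Sum>i=1..n. m i)) \<noteq> 0"
  using assms(2-)
proof (induction n)
  case (Suc n)
  define N where "N = (\<Sum>i=1..n. m i)"
  define b l where "b = a (Suc n)" and "l = m (Suc n)"
  define G where "G j = grid_functional A w n (\<lambda>x. diag_form a k n x ^ j)" for j
  \<comment> \<open>The power has degree at most \<open>k * j\<close>, which is less than
    \<open>k * N\<close>.\<close>
  have G0: "G j = 0" if "j < N" for j
  proof -
    have "deg_less n (Suc (k * j)) (\<lambda>x. diag_form a k n x ^ j)"
    proof (induction j)
      case (Suc j)
      from deg_less_mult[OF deg_less_diag_form[of n k a] Suc.IH] show ?case by simp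
    qed (simp add: deg_less_const)
    moreover have "Suc (k * j) \<le> (\<Sum>i=1..n. k * m i)"
    proof -
      have "k * j < k * N" using that assms(1) by simp
      then show ?thesis by (simp add: N_def sum_distrib_left Suc_le_eq)
    qed
    ultimately have "deg_less n (\<Sum>i=1..n. k * m i) (\<lambda>x. diag_form a k n x ^ j)"
      by (rule deg_less_mono)
    then show ?thesis unfolding G_def
      by (intro grid_functional_deg_less[where d = "\<lambda>i. k * m i"]) (use Suc.prems in auto)
  qed
  have GN: "G N \<noteq> 0"
    unfolding G_def N_def by (rule Suc.IH) (use Suc.prems in auto)
  have form: "diag_form a k (Suc n) (x(Suc n := y)) = b * y ^ k + diag_form a k n x" for x y
  proof -
    have "(\<Sum>i=1..n. a i * (x(Suc n := y)) i ^ k) = diag_form a k n x"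
      by (intro sum.cong) auto
    then show ?thesis by (simp add: b_def)
  qed
  define M where "M = N + l"
  have "grid_functional A w (Suc n) (\<lambda>x. diag_form a k (Suc n) x ^ M) =
      (\<Sum>y\<in>A (Suc n). w (Suc n) y * (\<Sum>j\<le>M. of_nat (M choose j) * (b * y ^ k) ^ j * G (M - j)))"
    by (simp only: grid_functional.simps form binomial_ring grid_functional_sum finite_atMost
        grid_functional_cmult G_def)
  also have "\<dots> = (\<Sum>j\<le>M. of_nat (M choose j) * b ^ j * G (M - j) *
      (\<Sum>y\<in>A (Suc n). w (Suc n) y * y ^ (k * j)))"
    by (simp only: sum_distrib_left)
       (subst sum.swap, simp add: power_mult_distrib mult_ac flip: power_mult)
  also have "\<dots> = (\<Sum>j\<in>{l}. of_nat (M choose j) * b ^ j * G (M - j) *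
      (\<Sum>y\<in>A (Suc n). w (Suc n) y * y ^ (k * j)))"
  proof (rule sum.mono_neutral_right)
    show "\<forall>j\<in>{..M} - {l}. of_nat (M choose j) * b ^ j * G (M - j) *
      (\<Sum>y\<in>A (Suc n). w (Suc n) y * y ^ (k * j)) = 0"
    proof
      fix j assume j: "j \<in> {..M} - {l}"
      show "of_nat (M choose j) * b ^ j * G (M - j) *
        (\<Sum>y\<in>A (Suc n). w (Suc n) y * y ^ (k * j)) = 0"
      \<comment> \<open>For \<open>j < l\<close> the moment in the new coordinate vanishes; for
        \<open>j > l\<close> the remaining power \<open>M - j\<close> is below
        \<open>N\<close>.\<close>
      proof (cases "j < l")
        case True
        then have "k * j < k * m (Suc n)" using assms(1) by (simp add: l_def)
        then show ?thesis using Suc.prems(1) by simp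
      next
        case False
        then have "M - j < N" using j by (auto simp: M_def)
        then show ?thesis using G0 by simp
      qed
    qed
  qed (auto simp: M_def)
  also have "\<dots> = of_nat (M choose l) * b ^ l * G N"
    using Suc.prems(2)[of "Suc n"] by (simp add: M_def l_def)
  also have "\<dots> \<noteq> 0"
  \<comment> \<open>Each coordinate contributes one binomial coefficient; together they form the
    multinomial coefficient.\<close>
  proof -
    have "CHAR('a) = 0 \<or> M < CHAR('a)"
      using Suc.prems(4) by (simp add: M_def N_def l_def)
    then have "(of_nat (M choose l) :: 'a) \<noteq> 0"
      by (rule of_nat_binomial_neq_0) (simp add: M_def)
    then show ?thesis using GN Suc.prems(3)[of "Suc n"] by (simp add: b_def)
  qed
  finally show ?case by (simp add: M_def N_def l_def)
qed simp

section \<open>The lower bound on grids of exact size\<close>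

text \<open>With \<open>k * m i + 1\<close> points in each coordinate, the extracted degrees add up
  to \<open>k * N\<close>, the degree of a product of \<open>N\<close> factors
  \<open>f - c\<close>.\<close>

lemma card_range_diag_form_plus_lower:
  fixes a :: "nat \<Rightarrow> 'a::field"
  assumes k: "k \<ge> 1" and a: "\<And>i. i \<in> {1..n} \<Longrightarrow> a i \<noteq> 0"
    and h: "deg_less n k h"
    and card: "\<And>i. i \<in> {1..n} \<Longrightarrow> card (A i) = Suc (k * m i)"
    and char: "CHAR('a) = 0 \<or> (\<Sum>i=1..n. m i) < CHAR('a)"
    and C: "finite C" "\<And>x. (\<And>i. i \<in> {1..n} \<Longrightarrow> x i \<in> A i) \<Longrightarrow> diag_form a k n x + h x \<in> C"
  shows "(\<Sum>i=1..n. m i) < card C"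
proof (rule ccontr)
  define N where "N = (\<Sum>i=1..n. m i)"
  assume "\<not> ?thesis"
  then have N: "card C \<le> N" by (simp add: N_def)
  obtain cs where cs: "set cs = C" "length cs = card C"
    using finite_distinct_list[OF C(1)] distinct_card by metis
  \<comment> \<open>The list of values is padded with 0 to length \<open>N\<close>; the extra
    factors do not spoil the vanishing on the grid.\<close>
  define c where "c j = (if j < card C then cs ! j else 0)" for j
  have c: "\<exists>j<N. c j = z" if "z \<in> C" for z
    using that N cs by (metis c_def in_set_conv_nth order_less_le_trans)
  have "\<forall>i\<in>{1..n}. \<exists>w. (\<forall>j<k * m i. (\<Sum>x\<in>A i. w x * x ^ j) = 0) \<and>
      (\<Sum>x\<in>A i. w x * x ^ (k * m i)) = 1"
    using extraction_weights_exist[OF card] by blast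
  from bchoice[OF this] obtain w where w: "\<And>i j. i \<in> {1..n} \<Longrightarrow> j < k * m i \<Longrightarrow> (\<Sum>y\<in>A i. w i y * y ^ j) = 0"
    "\<And>i. i \<in> {1..n} \<Longrightarrow> (\<Sum>y\<in>A i. w i y * y ^ (k * m i)) = 1"
    by blast
  define P where "P x = (\<Prod>j<N. diag_form a k n x + (h x + - c j))" for x
  have "grid_functional A w n P = 0"
  proof (rule grid_functional_eq_0)
    fix x assume "\<And>i. i \<in> {1..n} \<Longrightarrow> x i \<in> A i"
    then have "diag_form a k n x + h x \<in> C" by (rule C(2))
    then obtain j where "j < N" "c j = diag_form a k n x + h x" using c by blast
    then show "P x = 0" unfolding P_def by (intro prod_zero bexI[of _ j]) auto
  qed
  \<comment> \<open>The constants \<open>c j\<close> count as lower-order terms because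
    \<open>k\<close> is positive.\<close>
  moreover have "deg_less n (k * N) (\<lambda>x. P x - diag_form a k n x ^ N)"
    unfolding P_def
    by (intro deg_less_prod_minus_power deg_less_diag_form deg_less_add h deg_less_const)
       (use k in simp)
  then have "grid_functional A w n (\<lambda>x. P x - diag_form a k n x ^ N) = 0"
    by (intro grid_functional_deg_less[where d = "\<lambda>i. k * m i"])
       (auto simp: N_def sum_distrib_left w)
  moreover have "grid_functional A w n P = grid_functional A w n (\<lambda>x. P x - diag_form a k n x ^ N)
      + grid_functional A w n (\<lambda>x. diag_form a k n x ^ N)"
    by (subst grid_functional_add[symmetric]) simp
  ultimately show False
    using grid_functional_diag_form_power[OF k w a char] by (simp add: N_def)
qed

section \<open>Evaluation of formal polynomials\<close>

text \<open>Cancellation can shrink the keys of a sum, so additivity is proved over a common index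
  set.\<close>

lemma mp_eval_superset:
  assumes "finite B" "Poly_Mapping.keys p \<subseteq> B"
  shows "mp_eval p x = (\<Sum>m\<in>B. Poly_Mapping.lookup p m *
    (\<Prod>i\<in>Poly_Mapping.keys m. x i ^ Poly_Mapping.lookup m i))"
  unfolding mp_eval_def using assms
  by (intro sum.mono_neutral_left) (auto simp: in_keys_iff)

lemma mp_eval_0 [simp]: "mp_eval 0 x = 0"
  by (simp add: mp_eval_def)

lemma mp_eval_add: "mp_eval (p + q) x = mp_eval p x + mp_eval q x"
proof -
  let ?B = "Poly_Mapping.keys p \<union> Poly_Mapping.keys q"
  have "Poly_Mapping.keys (p + q) \<subseteq> ?B" by (rule Poly_Mapping.keys_add)
  then show ?thesis
    by (simp add: mp_eval_superset[of ?B] lookup_add distrib_right sum.distrib)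
qed

lemma mp_eval_sum: "mp_eval (sum p J) x = (\<Sum>j\<in>J. mp_eval (p j) x)"
  by (induction J rule: infinite_finite_induct) (simp_all add: mp_eval_add)

lemma mp_eval_single_power:
  "mp_eval (Poly_Mapping.single (Poly_Mapping.single i k) c) x = c * x i ^ k"
  \<comment> \<open>For \<open>k = 0\<close> the exponent vector \<open>single i 0\<close> is zero
    and has no keys.\<close>
  by (cases "k = 0") (simp_all add: mp_eval_def)

lemma mp_eval_deg_less:
  fixes g :: "'a::field mpoly"
  assumes "g \<in> mp_ring n" "total_degree g < k"
  shows "deg_less n k (mp_eval g)"
  unfolding mp_eval_def
proof (rule deg_less_sum)
  fix m assume m: "m \<in> Poly_Mapping.keys g"
  have sub: "Poly_Mapping.keys m \<subseteq> {1..n}"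
    using assms(1) m by (auto simp: mp_ring_def mp_vars_def)
  have "monom_degree m \<le> total_degree g"
    unfolding total_degree_def using m by (intro Max_ge) auto
  moreover have "monom_degree m = (\<Sum>i=1..n. Poly_Mapping.lookup m i)"
    unfolding monom_degree_def using sub by (intro sum.mono_neutral_left) (auto simp: in_keys_iff)
  ultimately have "(\<Sum>i=1..n. Poly_Mapping.lookup m i) < k" using assms(2) by simp
  moreover have "(\<Prod>i\<in>Poly_Mapping.keys m. x i ^ Poly_Mapping.lookup m i) =
      (\<Prod>i=1..n. x i ^ Poly_Mapping.lookup m i)" for x :: "nat \<Rightarrow> 'a"
    using sub by (intro prod.mono_neutral_left) (auto simp: in_keys_iff)
  ultimately show "deg_less n k (\<lambda>x. Poly_Mapping.lookup g m *
      (\<Prod>i\<in>Poly_Mapping.keys m. x i ^ Poly_Mapping.lookup m i))"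
    by (simp only: deg_less_monomial)
qed simp

section \<open>Finiteness of the range and choice of exponents\<close>

lemma deg_less_cong:
  "deg_less n D h \<Longrightarrow> (\<And>i. i \<in> {1..n} \<Longrightarrow> x i = y i) \<Longrightarrow> h x = h y"
  by (induction rule: deg_less.induct) auto

text \<open>The points \<open>x\<close> are arbitrary outside \<open>{1..n}\<close>; restricting
  them to these coordinates keeps the value and leaves finitely many points.\<close>

lemma finite_deg_less_image:
  assumes "deg_less n D h" "\<And>i. i \<in> {1..n} \<Longrightarrow> finite (A i)"
  shows "finite {h x | x. \<forall>i\<in>{1..n}. x i \<in> A i}"
proof (rule finite_subset)
  show "{h x | x. \<forall>i\<in>{1..n}. x i \<in> A i} \<subseteq> h ` PiE {1..n} A"
  proof
    fix z assume "z \<in> {h x | x. \<forall>i\<in>{1..n}. x i \<in> A i}"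
    then obtain x where x: "z = h x" "\<forall>i\<in>{1..n}. x i \<in> A i" by blast
    have "h x = h (restrict x {1..n})" by (rule deg_less_cong[OF assms(1)]) (simp only: restrict_apply if_True)
    with x show "z \<in> h ` PiE {1..n} A" by (intro image_eqI[of _ _ "restrict x {1..n}"]) auto
  qed
  show "finite (h ` PiE {1..n} A)" using assms(2) by (intro finite_imageI finite_PiE) auto
qed

text \<open>Greedy choice: the last coordinate takes as much of \<open>N\<close> as \<open>q\<close>
  allows. It serves to lower the exponents when the characteristic caps their sum.\<close>

lemma exists_smaller_with_sum:
  fixes q :: "nat \<Rightarrow> nat"
  assumes "N \<le> (\<Sum>i=1..n. q i)"
  shows "\<exists>m. (\<forall>i. m i \<le> q i) \<and> (\<Sum>i=1..n. m i) = N"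
  using assms
proof (induction n arbitrary: N)
  case 0
  then show ?case by (intro exI[of _ "\<lambda>_. 0"]) auto
next
  case (Suc n)
  then have "N - min N (q (Suc n)) \<le> (\<Sum>i=1..n. q i)" by (auto simp: min_def)
  from Suc.IH[OF this] obtain m where m: "\<forall>i. m i \<le> q i"
    "(\<Sum>i=1..n. m i) = N - min N (q (Suc n))" by blast
  have "(\<Sum>i=1..n. (m(Suc n := min N (q (Suc n)))) i) = (\<Sum>i=1..n. m i)"
    by (intro sum.cong) auto
  with m show ?case by (intro exI[of _ "m(Suc n := min N (q (Suc n)))"]) auto
qed

theorem theorem1p1:
  fixes n k :: nat
    and a :: "nat \<Rightarrow> 'a::field"
    and f g :: "'a mpoly"
    and A :: "nat \<Rightarrow> 'a set"
  assumes "n \<ge> 1" and "k \<ge> 1"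
    and "\<And>i. i \<in> {1..n} \<Longrightarrow> a i \<noteq> 0"
    and "g \<in> mp_ring n" and "total_degree g < k"
    and "f = (\<Sum>i=1..n. Poly_Mapping.single (Poly_Mapping.single i k) (a i)) + g"
    and "\<And>i. i \<in> {1..n} \<Longrightarrow> finite (A i) \<and> A i \<noteq> {}"
  shows "enat (card {mp_eval f x | x. \<forall>i\<in>{1..n}. x i \<in> A i}) \<ge>
    min (char_order TYPE('a))
        (enat (nat ((\<Sum>i=1..n. \<lfloor>(real (card (A i)) - 1) / real k\<rfloor>) + 1)))"
proof -
  define C where "C = {mp_eval f x | x. \<forall>i\<in>{1..n}. x i \<in> A i}"
  define q where "q i = (card (A i) - 1) div k" for i
  \<comment> \<open>The claimed bound is \<open>N + 1\<close>; the cap \<open>CHAR('a) - 1\<close>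
    keeps the multinomial coefficient nonzero.\<close>
  define N where "N = (if CHAR('a) = 0 then \<Sum>i=1..n. q i else min (CHAR('a) - 1) (\<Sum>i=1..n. q i))"
  \<comment> \<open>Nonemptiness makes the truncated subtraction in \<open>q\<close> agree with the
    real one.\<close>
  have pos: "card (A i) \<ge> 1" if "i \<in> {1..n}" for i
    using assms(7)[OF that] card_gt_0_iff[of "A i"] by linarith
  have "\<lfloor>(real (card (A i)) - 1) / real k\<rfloor> = int (q i)" if "i \<in> {1..n}" for i
  proof -
    have "real (card (A i)) - 1 = real (card (A i) - 1)" using pos[OF that] by (simp add: of_nat_diff)
    then show ?thesis by (simp only: floor_divide_of_nat_eq q_def)
  qed
  then have floors: "(\<Sum>i=1..n. \<lfloor>(real (card (A i)) - 1) / real k\<rfloor>) = int (\<Sum>i=1..n. q i)"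
    by simp
  have eval: "mp_eval f x = diag_form a k n x + mp_eval g x" for x
    by (simp add: assms(6) mp_eval_add mp_eval_sum mp_eval_single_power)
  have g: "deg_less n k (mp_eval g)" using assms(4,5) by (rule mp_eval_deg_less)
  have "deg_less n (Suc k) (mp_eval f)"
    unfolding eval by (intro deg_less_add deg_less_diag_form deg_less_mono[OF g]) simp
  then have finC: "finite C"
    unfolding C_def by (rule finite_deg_less_image) (use assms(7) in blast)
  have "N \<le> (\<Sum>i=1..n. q i)" by (simp add: N_def)
  then obtain m where m: "\<And>i. m i \<le> q i" "(\<Sum>i=1..n. m i) = N"
    using exists_smaller_with_sum by metis
  \<comment> \<open>Each \<open>A i\<close> is cut down to exactly \<open>k * m i + 1\<close>
    points; the values on the smaller grid still lie in \<open>C\<close>.\<close>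
  have "\<forall>i. \<exists>B. i \<in> {1..n} \<longrightarrow> B \<subseteq> A i \<and> card B = Suc (k * m i)"
  proof (intro allI)
    fix i
    have "Suc (k * m i) \<le> card (A i)" if i: "i \<in> {1..n}"
    proof -
      have "k * m i \<le> k * q i" using m(1) by simp
      also have "\<dots> \<le> card (A i) - 1" by (simp add: q_def)
      finally show ?thesis using pos[OF i] by simp
    qed
    then show "\<exists>B. i \<in> {1..n} \<longrightarrow> B \<subseteq> A i \<and> card B = Suc (k * m i)"
      by (metis obtain_subset_with_card_n)
  qed
  then obtain B where B: "\<And>i. i \<in> {1..n} \<Longrightarrow> B i \<subseteq> A i"
    "\<And>i. i \<in> {1..n} \<Longrightarrow> card (B i) = Suc (k * m i)"
    by metis
  have "(\<Sum>i=1..n. m i) < card C"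
  proof (rule card_range_diag_form_plus_lower[where A = B and h = "mp_eval g"])
    show "CHAR('a) = 0 \<or> (\<Sum>i=1..n. m i) < CHAR('a)" unfolding m(2) N_def by auto
    show "diag_form a k n x + mp_eval g x \<in> C" if "\<And>i. i \<in> {1..n} \<Longrightarrow> x i \<in> B i" for x
      unfolding C_def eval[symmetric] using that B(1) by blast
  qed (use assms(2,3) g B(2) finC in auto)
  then have "N < card C" by (simp add: m(2))
  moreover have "min (char_order TYPE('a)) (enat (nat (int (\<Sum>i=1..n. q i) + 1))) = enat (Suc N)"
  proof -
    have "nat (int (\<Sum>i=1..n. q i) + 1) = Suc (\<Sum>i=1..n. q i)" by (metis Suc_as_int nat_int)
    then show ?thesis
      by (cases "CHAR('a) = 0") (auto simp: char_order_def N_def min_def)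
  qed
  ultimately show ?thesis unfolding floors C_def by simp
qed

end
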